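(* Let $m,n$ be positive integers and let $A=(a_{ij})\in\mathbb{R}^{m\times n}$ be a given matrix. Then there exists a unique polynomial $P\in\mathcal{P}_m^n$ satisfying $a_{ij}=P(i,j)$ for all $i=1,\ldots,m$, $j=1,\ldots,n$, and it is given by $$P(x,y)=\sum_{r=1}^{n}\left\{\prod_{\alpha=1,\,\alpha\neq r}^{n}\frac{(y-\alpha)}{(r-\alpha)}\right\}p_r(x),$$ where $$p_r(x)=\sum_{k=1}^{m}\left\{\prod_{\alpha=1,\,\alpha\neq k}^{m}\frac{(x-\alpha)}{(k-\alpha)}\right\}a_{kr}\quad\text{for all } r=1,2,\ldots,n.$$
   Context: For positive integers $m,n$, $\mathcal{P}_m^n$ denotes the real vector space of polynomials in two variables $x,y$ of the form $P(x,y)=\sum_{k_1=0}^{m-1}\sum_{k_2=0}^{n-1}\lambda_{k_1,k_2}x^{k_1}y^{k_2}$ with $\lambda_{k_1,k_2}\in\mathbb{R}$. *)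

theory Defs
  imports "HOL-Computational_Algebra.Polynomial" "Jordan_Normal_Form.Matrix"
begin

text \<open>
  A polynomial in two variables x, y over the reals is an element of
  \<^typ>\<open>real poly poly\<close>: the outer variable is y, and the coefficients are polynomials in x.
\<close>

definition eval2 :: "real poly poly \<Rightarrow> real \<Rightarrow> real \<Rightarrow> real" where
  "eval2 P x y = poly (poly P [:y:]) x"

text \<open>The summand is the monomial \<open>c k1 k2 * x ^ k1 * y ^ k2\<close>.\<close>

definition bipoly_space :: "nat \<Rightarrow> nat \<Rightarrow> real poly poly set" where
  "bipoly_space m n =
     {P. \<exists>c :: nat \<Rightarrow> nat \<Rightarrow> real. P = (\<Sum>k1<m. \<Sum>k2<n. monom (monom (c k1 k2) k1) k2)}"

text \<open>
  Matrices of \<^typ>\<open>real mat\<close> are indexed from 0; \<open>entry A i j\<close> is the entry in the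
  i-th row and j-th column counted from 1, and is only meant for \<open>i, j \<ge> 1\<close>.
\<close>

definition entry :: "real mat \<Rightarrow> nat \<Rightarrow> nat \<Rightarrow> real" where
  "entry A i j = A $$ (i - 1, j - 1)"

definition column_interp :: "nat \<Rightarrow> real mat \<Rightarrow> nat \<Rightarrow> real \<Rightarrow> real" where
  "column_interp m A r x =
     (\<Sum>k=1..m. (\<Prod>\<alpha>\<in>{1..m} - {k}. (x - real \<alpha>) / (real k - real \<alpha>)) * entry A k r)"

end

theory Submission
  imports Defs
begin

text \<open>
  The idea is to apply one-variable Lagrange interpolation twice. For fixed \<open>x\<close>, a
  polynomial in the space is a polynomial in \<open>y\<close> with fewer than \<open>n\<close> coefficients, so it is
  recovered from its values at \<open>y = 1, ..., n\<close> (\<open>lagrange_formula\<close>). For each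
  such \<open>y = r\<close> it is a polynomial in \<open>x\<close> with fewer than \<open>m\<close> coefficients, so it is recovered
  from its values at \<open>x = 1, ..., m\<close>. Hence any element of the space
  satisfies a product Lagrange formula whose only data are its \<open>m * n\<close> values on
  the grid (\<open>eval2_lagrange_formula\<close>). This formula is the claimed closed form, and it gives
  uniqueness, because a bivariate polynomial over the reals is determined by its values
  (\<open>eval2_inject\<close>).

  For existence, the coefficient of \<open>x ^ k1 * y ^ k2\<close> in the closed form can be read off from
  the coefficients of the one-variable Lagrange basis polynomials; their degrees
  keep it inside the space (\<open>bipoly_interpolant_exists\<close>).
\<close>

section \<open>Lagrange interpolation in one variable\<close>

definition lagrange_basis :: "'i set \<Rightarrow> ('i \<Rightarrow> 'a::field) \<Rightarrow> 'i \<Rightarrow> 'a poly" where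
  "lagrange_basis I z r = (\<Prod>s\<in>I - {r}. Polynomial.smult (inverse (z r - z s)) [:- z s, 1:])"

lemma poly_lagrange_basis:
  "poly (lagrange_basis I z r) x = (\<Prod>s\<in>I - {r}. (x - z s) / (z r - z s))"
  unfolding lagrange_basis_def poly_prod
  by (intro prod.cong refl) (simp add: divide_inverse algebra_simps)

lemma degree_lagrange_basis:
  assumes "finite I" "r \<in> I"
  shows "degree (lagrange_basis I z r) < card I"
proof -
  have "degree (lagrange_basis I z r)
      \<le> (\<Sum>s\<in>I - {r}. degree (Polynomial.smult (inverse (z r - z s)) [:- z s, 1:]))"
    unfolding lagrange_basis_def
    by (rule degree_prod_sum_le[unfolded o_def]) (use assms in simp)
  also have "\<dots> \<le> (\<Sum>s\<in>I - {r}. 1)"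
    by (intro sum_mono) simp
  also have "\<dots> < card I"
    using card_Diff1_less[OF assms] assms by simp
  finally show ?thesis .
qed

lemma poly_lagrange_basis_node:
  assumes "finite I" "inj_on z I" "r \<in> I" "k \<in> I"
  shows "poly (lagrange_basis I z r) (z k) = (if k = r then 1 else 0)"
proof (cases "k = r")
  case True
  have "(\<Prod>s\<in>I - {r}. (z r - z s) / (z r - z s)) = 1"
    using assms by (intro prod.neutral) (auto dest: inj_onD)
  with True show ?thesis by (simp add: poly_lagrange_basis)
next
  case False
  with assms show ?thesis by (auto simp: poly_lagrange_basis prod_zero_iff)
qed

lemma sum_lagrange_basis_node:
  assumes "finite I" "inj_on z I" "k \<in> I"
  shows "(\<Sum>r\<in>I. poly (lagrange_basis I z r) (z k) * f r) = f k"
proof -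
  have "(\<Sum>r\<in>I. poly (lagrange_basis I z r) (z k) * f r) = (\<Sum>r\<in>I. if k = r then f r else 0)"
    using assms by (intro sum.cong refl) (simp add: poly_lagrange_basis_node)
  with assms show ?thesis by simp
qed

text \<open>
  Both sides have degree below the number of nodes and agree at every node, so
  their difference has too many roots to be nonzero.
\<close>

lemma lagrange_formula:
  fixes p :: "'a::field poly"
  assumes "finite I" "inj_on z I" "degree p < card I"
  shows "poly p x = (\<Sum>r\<in>I. poly (lagrange_basis I z r) x * poly p (z r))"
proof -
  define q where "q = (\<Sum>r\<in>I. Polynomial.smult (poly p (z r)) (lagrange_basis I z r))"
  have q: "poly q t = (\<Sum>r\<in>I. poly (lagrange_basis I z r) t * poly p (z r))" for t
    by (simp add: q_def poly_sum mult.commute)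
  have "degree q < card I"
    unfolding q_def using assms degree_lagrange_basis[OF assms(1)]
    by (intro degree_sum_less) (auto intro: le_less_trans[OF degree_smult_le])
  moreover have "poly p t = poly q t" if "t \<in> z ` I" for t
    using that assms(1,2) sum_lagrange_basis_node[of I z _ "\<lambda>r. poly p (z r)"]
    by (auto simp: q)
  ultimately have "p = q"
    using assms by (intro poly_eqI_degree[of "z ` I"]) (auto simp: card_image)
  then have "poly p x = poly q x"
    by (rule arg_cong)
  also note q
  finally show ?thesis .
qed

lemma poly_sum_monom_lessThan:
  fixes x :: "'a::comm_semiring_1"
  shows "poly (\<Sum>k<n. monom (a k) k) x = (\<Sum>k<n. a k * x ^ k)"
  by (simp add: poly_sum poly_monom)

lemma degree_sum_monom_less:
  assumes "n > 0"
  shows "degree (\<Sum>k<n. monom (a k) k) < n"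
  using assms by (intro degree_sum_less) (auto intro: le_less_trans[OF degree_monom_le])

lemma poly_as_sum_lessThan:
  fixes p :: "'a::comm_semiring_1 poly"
  assumes "degree p < n"
  shows "poly p x = (\<Sum>k<n. coeff p k * x ^ k)"
proof -
  have "(\<Sum>k\<le>degree p. coeff p k * x ^ k) = (\<Sum>k<n. coeff p k * x ^ k)"
    using assms by (intro sum.mono_neutral_left) (auto simp: coeff_eq_0 not_le)
  then show ?thesis by (simp add: poly_altdef)
qed

text \<open>
  The shape in which the one-variable formula is used below: the function is given as an explicit
  sum of fewer than \<open>n\<close> powers, since a section of a bivariate polynomial arises in this form.
\<close>

lemma lagrange_formula_power_sum:
  fixes a :: "nat \<Rightarrow> real"
  assumes f: "\<And>t. f t = (\<Sum>k<n. a k * t ^ k)" and "n > 0"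
  shows "f x = (\<Sum>r=1..n. poly (lagrange_basis {1..n} real r) x * f (real r))"
proof -
  define p where "p = (\<Sum>k<n. monom (a k) k)"
  have "poly p t = f t" for t
    by (simp only: p_def poly_sum_monom_lessThan f)
  moreover have "degree p < card {1..n}"
    using degree_sum_monom_less[OF \<open>n > 0\<close>] by (simp add: p_def)
  ultimately show ?thesis
    using lagrange_formula[of "{1..n}" real p x] by (simp add: inj_on_def)
qed

section \<open>Polynomials in two variables as functions\<close>

lemma eval2_sum_monom:
  "eval2 (\<Sum>k1<m. \<Sum>k2<n. monom (monom (c k1 k2) k1) k2) x y
     = (\<Sum>k1<m. \<Sum>k2<n. c k1 k2 * x ^ k1 * y ^ k2)"
  by (simp add: eval2_def poly_sum poly_monom poly_power)

text \<open>
  For each \<open>y\<close>, equality of the values at all \<open>x\<close> gives equality of the polynomials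
  obtained by substituting the constant \<open>y\<close>. The difference of the two outer polynomials then has
  all the infinitely many constants as roots.
\<close>

lemma eval2_inject:
  assumes "\<And>x y. eval2 P x y = eval2 Q x y"
  shows "P = Q"
proof (rule ccontr)
  assume "P \<noteq> Q"
  then have "finite {t. poly (P - Q) t = 0}"
    by (intro poly_roots_finite) simp
  moreover have "poly P [:y:] = poly Q [:y:]" for y
    using assms[of _ y] by (intro poly_ext) (simp add: eval2_def)
  then have "range (\<lambda>y::real. [:y:]) \<subseteq> {t. poly (P - Q) t = 0}"
    by auto
  ultimately have "finite (range (\<lambda>y::real. [:y:]))"
    by (rule rev_finite_subset)
  then show False
    by (simp add: finite_image_iff inj_on_def infinite_UNIV_char_0)
qed

section \<open>Interpolation on a grid\<close>

text \<open>
  The values at the grid points are the only data of \<open>P\<close> on the right-hand side, because the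
  one-variable formula is applied first along the vertical line through \<open>x\<close> and then
  along each horizontal line \<open>y = r\<close>.
\<close>

lemma eval2_lagrange_formula:
  assumes "P \<in> bipoly_space m n" "m > 0" "n > 0"
  shows "eval2 P x y =
    (\<Sum>r=1..n. poly (lagrange_basis {1..n} real r) y *
      (\<Sum>k=1..m. poly (lagrange_basis {1..m} real k) x * eval2 P (real k) (real r)))"
proof -
  obtain c where c: "P = (\<Sum>k1<m. \<Sum>k2<n. monom (monom (c k1 k2) k1) k2)"
    using assms(1) by (auto simp: bipoly_space_def)
  have in_y: "eval2 P x t = (\<Sum>k2<n. (\<Sum>k1<m. c k1 k2 * x ^ k1) * t ^ k2)" for t
    unfolding c eval2_sum_monom by (subst sum.swap) (simp add: sum_distrib_right)
  have in_x: "eval2 P t s = (\<Sum>k1<m. (\<Sum>k2<n. c k1 k2 * s ^ k2) * t ^ k1)" for t s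
    unfolding c eval2_sum_monom by (simp add: sum_distrib_left sum_distrib_right mult_ac)
  have "eval2 P x y
      = (\<Sum>r=1..n. poly (lagrange_basis {1..n} real r) y * eval2 P x (real r))"
    by (rule lagrange_formula_power_sum[where f = "eval2 P x", OF in_y assms(3)])
  also have "\<dots> = (\<Sum>r=1..n. poly (lagrange_basis {1..n} real r) y *
      (\<Sum>k=1..m. poly (lagrange_basis {1..m} real k) x * eval2 P (real k) (real r)))"
    by (intro sum.cong refl arg_cong2[of _ _ _ _ "(*)"]
        lagrange_formula_power_sum[where f = "\<lambda>t. eval2 P t _", OF in_x assms(2)])
  finally show ?thesis .
qed

text \<open>
  The interpolant is \<open>\<Sum>k r. a k r * u k x * v r y\<close> with the Lagrange basis polynomials \<open>u k\<close>
  and \<open>v r\<close> in the two variables. Writing it through its coefficients \<open>c k1 k2\<close> makes membership in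
  the space immediate and moves the work into rearranging a fourfold sum. Truncating
  the expansions at \<open>m\<close> and \<open>n\<close> loses nothing, by the degree bound on the basis polynomials.
\<close>

lemma bipoly_interpolant_exists:
  fixes a :: "nat \<Rightarrow> nat \<Rightarrow> real"
  shows "\<exists>P\<in>bipoly_space m n. \<forall>i\<in>{1..m}. \<forall>j\<in>{1..n}. eval2 P (real i) (real j) = a i j"
proof -
  define u where "u = lagrange_basis {1..m} real"
  define v where "v = lagrange_basis {1..n} real"
  define c where
    "c k1 k2 = (\<Sum>k=1..m. \<Sum>r=1..n. a k r * coeff (u k) k1 * coeff (v r) k2)" for k1 k2
  define P where "P = (\<Sum>k1<m. \<Sum>k2<n. monom (monom (c k1 k2) k1) k2)"
  have u: "(\<Sum>k1<m. coeff (u k) k1 * x ^ k1) = poly (u k) x" if "k \<in> {1..m}" for k x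
    using degree_lagrange_basis[OF finite_atLeastAtMost that, of real]
    by (intro poly_as_sum_lessThan[symmetric]) (simp add: u_def)
  have v: "(\<Sum>k2<n. coeff (v r) k2 * y ^ k2) = poly (v r) y" if "r \<in> {1..n}" for r y
    using degree_lagrange_basis[OF finite_atLeastAtMost that, of real]
    by (intro poly_as_sum_lessThan[symmetric]) (simp add: v_def)
  have "eval2 P x y = (\<Sum>k=1..m. poly (u k) x * (\<Sum>r=1..n. poly (v r) y * a k r))" for x y
  proof -
    have "eval2 P x y = (\<Sum>k1<m. \<Sum>k2<n. \<Sum>k=1..m. \<Sum>r=1..n.
        a k r * (coeff (u k) k1 * x ^ k1) * (coeff (v r) k2 * y ^ k2))"
      by (simp add: P_def eval2_sum_monom c_def sum_distrib_left sum_distrib_right mult_ac)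
    also have "\<dots> = (\<Sum>k1<m. \<Sum>k=1..m. \<Sum>k2<n. \<Sum>r=1..n.
        a k r * (coeff (u k) k1 * x ^ k1) * (coeff (v r) k2 * y ^ k2))"
      by (intro sum.cong refl sum.swap)
    also have "\<dots> = (\<Sum>k=1..m. \<Sum>k1<m. \<Sum>k2<n. \<Sum>r=1..n.
        a k r * (coeff (u k) k1 * x ^ k1) * (coeff (v r) k2 * y ^ k2))"
      by (rule sum.swap)
    also have "\<dots> = (\<Sum>k=1..m. \<Sum>k1<m. \<Sum>r=1..n. \<Sum>k2<n.
        a k r * (coeff (u k) k1 * x ^ k1) * (coeff (v r) k2 * y ^ k2))"
      by (intro sum.cong refl sum.swap)
    also have "\<dots> = (\<Sum>k=1..m. (\<Sum>k1<m. coeff (u k) k1 * x ^ k1) *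
        (\<Sum>r=1..n. (\<Sum>k2<n. coeff (v r) k2 * y ^ k2) * a k r))"
      unfolding sum_product by (simp add: sum_distrib_left sum_distrib_right mult_ac)
    finally show ?thesis by (simp add: u v)
  qed
  then have "eval2 P (real i) (real j) = a i j" if "i \<in> {1..m}" "j \<in> {1..n}" for i j
    using that
    by (simp only: u_def v_def sum_lagrange_basis_node[OF finite_atLeastAtMost inj_on_of_nat])
  moreover have "P \<in> bipoly_space m n"
    by (auto simp: bipoly_space_def P_def)
  ultimately show ?thesis by blast
qed

theorem theorem3p2:
  fixes m n :: nat and A :: "real mat"
  assumes "m > 0" and "n > 0" and "A \<in> carrier_mat m n"
  shows "(\<exists>!P. P \<in> bipoly_space m n \<and>
            (\<forall>i\<in>{1..m}. \<forall>j\<in>{1..n}. entry A i j = eval2 P (real i) (real j))) \<and>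
         (\<forall>P. P \<in> bipoly_space m n \<and>
            (\<forall>i\<in>{1..m}. \<forall>j\<in>{1..n}. entry A i j = eval2 P (real i) (real j)) \<longrightarrow>
            (\<forall>x y. eval2 P x y =
               (\<Sum>r=1..n. (\<Prod>\<alpha>\<in>{1..n} - {r}. (y - real \<alpha>) / (real r - real \<alpha>))
                           * column_interp m A r x)))"
proof -
  let ?interp = "\<lambda>P. P \<in> bipoly_space m n \<and>
    (\<forall>i\<in>{1..m}. \<forall>j\<in>{1..n}. entry A i j = eval2 P (real i) (real j))"
  have formula: "eval2 P x y =
      (\<Sum>r=1..n. (\<Prod>\<alpha>\<in>{1..n} - {r}. (y - real \<alpha>) / (real r - real \<alpha>))
        * column_interp m A r x)" if "?interp P" for P x y
  proof -
    have "eval2 P x y = (\<Sum>r=1..n. poly (lagrange_basis {1..n} real r) y *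
        (\<Sum>k=1..m. poly (lagrange_basis {1..m} real k) x * eval2 P (real k) (real r)))"
      using that assms by (intro eval2_lagrange_formula) auto
    also have "\<dots> = (\<Sum>r=1..n. poly (lagrange_basis {1..n} real r) y * column_interp m A r x)"
      using that by (simp add: column_interp_def poly_lagrange_basis)
    finally show ?thesis by (simp add: poly_lagrange_basis)
  qed
  obtain P where P: "?interp P"
    using bipoly_interpolant_exists[of m n "entry A"] by force
  have "Q = P" if "?interp Q" for Q
    by (rule eval2_inject) (simp only: formula[OF that] formula[OF P])
  with P have "\<exists>!P. ?interp P" by blast
  with formula show ?thesis by blast
qed

end
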